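(* Let $E\subseteq\mathbb R$ be an interval with closure $\overline E=[L,R]$ in $[-\infty,\infty]$, where $L,R\in[-\infty,\infty]$. Let $(X_t)_{t\ge 0}$ be a stochastic process adapted to a filtration $(\mathcal F_t)_{t\ge0}$, let $\mu$ be a probability measure on $E$ and let $\xi$ be a random variable with values in $(0,\infty)$. Assume: (U1) there is a family of probability measures $(\mathbb P_x)_{x\in E}$ such that $\mathbb P_x(X_t\in E\ \forall t\ge 0)=1$ for all $x\in E$ and $((X_t)_{t\ge0},(\mathcal F_t)_{t\ge0},(\mathbb P_x)_{x\in E})$ is a (time-homogeneous) Markov process; (U2) for all probability measures $\mu_1,\mu_2$ on $E$ and all $t>0$, $\mu_1\preceq_{\mathrm{st}}\mu_2$ implies $\mathbb P_{\mu_1}(X_t\in\cdot\,)\preceq_{\mathrm{st}}\mathbb P_{\mu_2}(X_t\in\cdot\,)$. With $\mathbb P:=\mathbb P_\mu$ assume moreover: (E1) for every $t>0$ the probability measure $\mathbb P(X_t\in\cdot\,)$ is diffuse; (E2) $(X_t)_{t\ge 0}$ has $\mathbb P$-a.s. right-continuous paths and is quasi-left-continuous; (E3) for every boundary function $b$ it holds $\mathbb P$-a.s. that $\tau_b=\tau_b'$; (U3) $I^\xi\subseteq(0,t^\xi)$ is a set such that for every boundary function $b$ with values in $\overline E$ and such that $\tau_b$ has the same distribution as $\xi$ (under $\mathbb P$) we have $$b(t)=\sup\operatorname{supp}\bigl(\mathbb P(X_t\in\cdot\mid\tau_b>t)\bigr)\qquad\text{for all }t\in I^\xi .$$ Then all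 boundary functions $b$ with values in $\overline E$ such that $\tau_b$ has the same distribution as $\xi$ under $\mathbb P$ coincide on $I^\xi$.
   Context: A probability measure is diffuse if it has no atoms. A boundary function is a lower semicontinuous function $b:[0,\infty]\to[-\infty,\infty]$. For a boundary function $b$, $\tau_b:=\inf\{t>0: X_t\ge b(t)\}$ and $\tau_b':=\inf\{t>0: X_t>b(t)\}$ ($t$ ranging over $(0,\infty)$, $\inf\emptyset=\infty$). Quasi-left-continuity (under $\mathbb P$): for every non-decreasing sequence of stopping times $T_1\le T_2\le\dots$ with $T:=\lim_n T_n$ one has $\lim_n X_{T_n}=X_T$ $\mathbb P$-a.s. on $\{T<\infty\}$. Markov process means: $\mathbb P_x(X_0=x)=1$, $x\mapsto\mathbb P_x(A)$ is measurable for events $A$ determined by $X$, and $\mathbb P_x(X_{t+s}\in B\mid\mathcal F_t)=\mathbb P_{X_t}(X_s\in B)$ $\mathbb P_x$-a.s. for all $s,t\ge0$, $x\in E$ and Borel $B\subseteq E$. For a probability measure $\nu$ on $E$, $\mathbb P_\nu:=\int_E\mathbb P_x\,\nu(dx)$. The filtration is understood to fulfill the usual conditions under $\mathbb P_\mu$. For probability measures $\mu,\nu$ on $\mathbb R$, $\mu\preceq_{\mathrm{st}}\nu$ means $\mu((-\infty,c])\ge\nu((-\infty,c])$ for all $c\in\mathbb R$. For a measure $\mu$ on $\mathbb R$, $\operatorname{supp}(\mu):=\{x\in\mathbb R:\mu(U)>0\text{ for every open }U\ni x\}$. Finally $t^\xi:=\sup\{t>0:\mathbb P(\xi>t)>0\}$.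 *)

theory Defs
  imports "HOL-Probability.Probability"
begin

text \<open>
  Conventions. The measurable space \<open>M\<close> carries the laws \<open>Px x\<close> (only its \<sigma>-algebra is used);
  time-indexed families have index type \<^typ>\<open>real\<close> and are only constrained at times \<open>t \<ge> 0\<close>.
  The extended time axis \<open>[0,\<infinity>]\<close> is \<^typ>\<open>ennreal\<close> and \<open>[-\<infinity>,\<infinity>]\<close> is \<^typ>\<open>ereal\<close>.
  ``Almost surely'' is \<^const>\<open>almost_everywhere\<close>, which only asks that the exceptional set be
  contained in a measurable null set.
\<close>

subsection \<open>Measures on the real line\<close>

definition prob_measure_on :: "real set \<Rightarrow> real measure \<Rightarrow> bool" where
  "prob_measure_on E \<nu> \<longleftrightarrow> prob_space \<nu> \<and> sets \<nu> = sets borel \<and> emeasure \<nu> E = 1"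

definition diffuse :: "real measure \<Rightarrow> bool" where
  "diffuse \<nu> \<longleftrightarrow> (\<forall>x. emeasure \<nu> {x} = 0)"

definition st_le :: "real measure \<Rightarrow> real measure \<Rightarrow> bool" where
  "st_le \<nu>1 \<nu>2 \<longleftrightarrow> (\<forall>c. measure \<nu>1 {..c} \<ge> measure \<nu>2 {..c})"

definition msupp :: "real measure \<Rightarrow> real set" where
  "msupp \<nu> = {x. \<forall>U. open U \<and> x \<in> U \<longrightarrow> emeasure \<nu> U > 0}"

subsection \<open>Markov processes\<close>

definition adapted_process ::
    "'w measure \<Rightarrow> (real \<Rightarrow> 'w measure) \<Rightarrow> (real \<Rightarrow> 'w \<Rightarrow> real) \<Rightarrow> bool" where
  "adapted_process M F X \<longleftrightarrow>
     (\<forall>t\<ge>0. subalgebra M (F t)) \<and>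
     (\<forall>s t. 0 \<le> s \<and> s \<le> t \<longrightarrow> sets (F s) \<subseteq> sets (F t)) \<and>
     (\<forall>t\<ge>0. X t \<in> borel_measurable (F t))"

definition process_algebra :: "'w measure \<Rightarrow> (real \<Rightarrow> 'w \<Rightarrow> real) \<Rightarrow> 'w measure" where
  "process_algebra M X =
     sigma (space M) {X t -` B \<inter> space M | t B. 0 \<le> t \<and> B \<in> sets borel}"

definition markov_process ::
    "real set \<Rightarrow> 'w measure \<Rightarrow> (real \<Rightarrow> 'w measure) \<Rightarrow> (real \<Rightarrow> 'w \<Rightarrow> real) \<Rightarrow>
     (real \<Rightarrow> 'w measure) \<Rightarrow> bool" where
  "markov_process E M F X Px \<longleftrightarrow>
     (\<forall>x\<in>E. prob_space (Px x) \<and> sets (Px x) = sets M) \<and>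
     (\<forall>x\<in>E. AE \<omega> in Px x. X 0 \<omega> = x) \<and>
     (\<forall>A\<in>sets (process_algebra M X).
        (\<lambda>x. measure (Px x) A) \<in> borel_measurable (restrict_space borel E)) \<and>
     (\<forall>x\<in>E. \<forall>s\<ge>0. \<forall>t\<ge>0. \<forall>B\<in>sets borel. B \<subseteq> E \<longrightarrow>
        (AE \<omega> in Px x.
           real_cond_exp (Px x) (F t) (\<lambda>\<omega>'. indicator B (X (t + s) \<omega>')) \<omega> =
           measure (Px (X t \<omega>)) {\<omega>' \<in> space M. X s \<omega>' \<in> B}))"

text \<open>
  The mixture of the \<open>Px x\<close> with respect to \<open>\<nu>\<close>, that is \<open>A \<mapsto> \<integral>\<^sub>E Px x A \<nu>(dx)\<close>. It is a
  measure on the events determined by \<open>X\<close> (\<open>process_algebra M X\<close>), because only for these is \<open>x \<mapsto> Px x A\<close> assumed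
  to be measurable.
\<close>

definition mixture ::
    "real set \<Rightarrow> 'w measure \<Rightarrow> (real \<Rightarrow> 'w \<Rightarrow> real) \<Rightarrow> (real \<Rightarrow> 'w measure) \<Rightarrow>
     real measure \<Rightarrow> 'w measure" where
  "mixture E M X Px \<nu> =
     bind (restrict_space \<nu> E) (\<lambda>x. restr_to_subalg (Px x) (process_algebra M X))"

text \<open>
  \<open>Q\<close> is the mixture as a probability measure on all of \<open>M\<close>. If \<open>M\<close> is generated by \<open>X\<close> then
  \<open>Q\<close> is the mixture itself; if \<open>M\<close> is larger (to accommodate a larger filtration, or a random
  variable that is not a function of \<open>X\<close>), the integral formula determines \<open>Q\<close> on the events
  determined by \<open>X\<close> and nothing is assumed about the remaining ones.
\<close>

definition mixture_law ::
    "real set \<Rightarrow> 'w measure \<Rightarrow> (real \<Rightarrow> 'w \<Rightarrow> real) \<Rightarrow> (real \<Rightarrow> 'w measure) \<Rightarrow>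
     real measure \<Rightarrow> 'w measure \<Rightarrow> bool" where
  "mixture_law E M X Px \<nu> Q \<longleftrightarrow>
     prob_space Q \<and> sets Q = sets M \<and>
     restr_to_subalg Q (process_algebra M X) = mixture E M X Px \<nu>"

subsection \<open>Path regularity\<close>

text \<open>
  The usual augmentation of \<open>F\<close> under a complete probability measure \<open>P\<close>: the smallest
  right-continuous filtration that contains \<open>F\<close> and all \<open>P\<close>-null sets. It equals \<open>F\<close> when \<open>F\<close>
  already fulfills the usual conditions under \<open>P\<close>. At \<open>t = \<infinity>\<close> the condition is void, which is
  irrelevant for stopping times. The Markov property under the \<open>Px x\<close> has to be stated for the
  filtration before augmentation: null sets of \<open>P\<close> such as \<open>{X 0 = x} \<inter> A\<close> need not be null
  under \<open>Px x\<close>.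
\<close>

definition usual_augmentation ::
    "'w measure \<Rightarrow> (real \<Rightarrow> 'w measure) \<Rightarrow> ennreal \<Rightarrow> 'w measure" where
  "usual_augmentation P F t =
     sigma (space P)
       {A. A \<subseteq> space P \<and>
           (\<forall>s. t < ennreal s \<longrightarrow> A \<in> sigma_sets (space P) (sets (F s) \<union> null_sets P))}"

definition right_continuous_paths :: "'w measure \<Rightarrow> (real \<Rightarrow> 'w \<Rightarrow> real) \<Rightarrow> bool" where
  "right_continuous_paths P X \<longleftrightarrow>
     (AE \<omega> in P. \<forall>t\<ge>0. continuous (at_right t) (\<lambda>s. X s \<omega>))"

definition quasi_left_continuous ::
    "'w measure \<Rightarrow> (real \<Rightarrow> 'w measure) \<Rightarrow> (real \<Rightarrow> 'w \<Rightarrow> real) \<Rightarrow> bool" where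
  "quasi_left_continuous P F X \<longleftrightarrow>
     (\<forall>T :: nat \<Rightarrow> 'w \<Rightarrow> ennreal.
        (\<forall>n. stopping_time (usual_augmentation P F) (T n)) \<and>
        (\<forall>\<omega>\<in>space P. incseq (\<lambda>n. T n \<omega>)) \<longrightarrow>
        (AE \<omega> in P. (SUP n. T n \<omega>) < \<infinity> \<longrightarrow>
           (\<lambda>n. X (enn2real (T n \<omega>)) \<omega>) \<longlonglongrightarrow> X (enn2real (SUP n. T n \<omega>)) \<omega>))"

subsection \<open>Boundary functions and first-passage times\<close>

definition boundary_function :: "(ennreal \<Rightarrow> ereal) \<Rightarrow> bool" where
  "boundary_function b \<longleftrightarrow> (\<forall>c. open {t. c < b t})"

definition tau :: "(real \<Rightarrow> 'w \<Rightarrow> real) \<Rightarrow> (ennreal \<Rightarrow> ereal) \<Rightarrow> 'w \<Rightarrow> ennreal" where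
  "tau X b \<omega> = (INF t \<in> {t. 0 < t \<and> ereal (X t \<omega>) \<ge> b (ennreal t)}. ennreal t)"

definition tau' :: "(real \<Rightarrow> 'w \<Rightarrow> real) \<Rightarrow> (ennreal \<Rightarrow> ereal) \<Rightarrow> 'w \<Rightarrow> ennreal" where
  "tau' X b \<omega> = (INF t \<in> {t. 0 < t \<and> ereal (X t \<omega>) > b (ennreal t)}. ennreal t)"

text \<open>
  The measurability clause is needed because \<^const>\<open>distr\<close> is only meaningful for measurable
  maps; \<open>P\<close> will be complete.
\<close>

definition same_distribution ::
    "'w measure \<Rightarrow> ('w \<Rightarrow> ennreal) \<Rightarrow> ('w \<Rightarrow> real) \<Rightarrow> bool" where
  "same_distribution P \<tau> \<xi> \<longleftrightarrow>
     \<tau> \<in> borel_measurable P \<and> distr P borel \<tau> = distr P borel (\<lambda>\<omega>. ennreal (\<xi> \<omega>))"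

definition t_sup :: "'w measure \<Rightarrow> ('w \<Rightarrow> real) \<Rightarrow> ennreal" where
  "t_sup P \<xi> = (SUP t \<in> {t. 0 < t \<and> measure P {\<omega> \<in> space P. \<xi> \<omega> > t} > 0}. ennreal t)"

definition cond_law ::
    "'w measure \<Rightarrow> (real \<Rightarrow> 'w \<Rightarrow> real) \<Rightarrow> ('w \<Rightarrow> ennreal) \<Rightarrow> real \<Rightarrow> real measure" where
  "cond_law P X \<tau> t = distr (uniform_measure P {\<omega> \<in> space P. \<tau> \<omega> > ennreal t}) borel (X t)"

end

theory Submission
  imports Defs
begin

text \<open>
  For a solution \<open>b\<close> put \<open>\<kappa> b t c = P (tau X b > t, X t \<le> c)\<close>. Given two solutions \<open>b1\<close>, \<open>b2\<close> we compare
  \<open>\<kappa> b1 t\<close> with \<open>\<nu> t c = P (X u \<le> b2 u for all u \<in> S, X t \<le> c)\<close> for a finite set \<open>S\<close> of times up to \<open>t\<close>.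
  Transition kernels preserve the pointwise order of the distribution functions of sub-probability measures
  (killed mass sits at \<open>\<infinity>\<close>). At a time \<open>u \<in> S\<close> the measure on the right is cut at the level \<open>b2 u\<close>, which
  lowers its mass to some \<open>g\<close> and replaces its distribution function \<open>h\<close> by \<open>min h g\<close>; the mass of
  \<open>\<kappa> b1 u\<close> is \<open>P (\<xi> > u) = P (tau X b2 > u) \<le> g\<close>, so the order survives. Hence \<open>\<kappa> b1 t \<le> \<nu> t\<close>.
  Now let \<open>S\<close> exhaust a countable set of times that is dense from the right for the graph of \<open>b2\<close>. By right-continuity,
  \<open>tau = tau'\<close> and diffuseness, \<open>\<nu> t\<close> decreases to \<open>\<kappa> b2 t\<close>. By symmetry \<open>\<kappa> b1 = \<kappa> b2\<close>, so the
  conditional laws agree, and they determine the boundaries on \<open>I\<close>.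
\<close>

section \<open>Countable sets of times that are dense from the right\<close>

text \<open>Pick one point of \<open>B\<close> in every rational interval that meets
  \<open>B\<close>, and add the points of \<open>B\<close> that are isolated from the right. The
  latter are countable: each has a rational \<open>r\<close> to its right with no point of
  \<open>B\<close> in between, and for fixed \<open>r\<close> two such points would contradict each
  other.\<close>

lemma countable_right_dense:
  fixes B :: "real set"
  obtains D where "countable D" "D \<subseteq> B"
    "\<And>s e. s \<in> B \<Longrightarrow> 0 < e \<Longrightarrow> \<exists>u\<in>D. s \<le> u \<and> u < s + e"
proof
  define J where "J = {(p, r). p \<in> \<rat> \<and> r \<in> \<rat> \<and> B \<inter> {p<..<r} \<noteq> {}}"
  define pick where "pick = (\<lambda>(p, r). SOME x. x \<in> B \<inter> {p<..<r})"
  define S where "S r = {s \<in> B. s < r \<and> B \<inter> {s<..<r} = {}}" for r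
  define D where "D = pick ` J \<union> (\<Union>r\<in>\<rat>. S r)"
  have pick: "pick (p, r) \<in> B \<inter> {p<..<r}" if "(p, r) \<in> J" for p r
    using that some_in_eq[of "B \<inter> {p<..<r}"] by (simp add: J_def pick_def)
  have "countable J" unfolding J_def
    by (rule countable_subset[of _ "\<rat> \<times> \<rat>"]) (auto simp: countable_rat)
  moreover have "countable (S r)" for r
  proof -
    have "x = y" if "x \<in> S r" "y \<in> S r" for x y
      using that unfolding S_def by (cases x y rule: linorder_cases) auto
    then have "S r = {} \<or> (\<exists>x. S r = {x})" by blast
    then show ?thesis by auto
  qed
  ultimately show "countable D"
    by (simp add: D_def countable_rat)
  show "D \<subseteq> B" using pick by (force simp: D_def S_def)
  show "\<exists>u\<in>D. s \<le> u \<and> u < s + e" if "s \<in> B" "0 < e" for s e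
  proof -
    obtain r where r: "r \<in> \<rat>" "s < r" "r < s + e"
      using Rats_dense_in_real[of s "s + e"] \<open>0 < e\<close> by auto
    show ?thesis
    proof (cases "B \<inter> {s<..<r} = {}")
      case True
      then have "s \<in> D" using r \<open>s \<in> B\<close> by (auto simp: D_def S_def)
      then show ?thesis using \<open>0 < e\<close> by auto
    next
      case False
      then obtain v where v: "v \<in> B" "s < v" "v < r" by auto
      \<comment> \<open>With \<open>p\<close> above \<open>s\<close> the interval from
        \<open>p\<close> to \<open>r\<close> still contains \<open>v\<close>, so it belongs to
        \<open>J\<close>, and its chosen point lies strictly between \<open>s\<close> and
        \<open>s + e\<close>.\<close>
      obtain p where p: "p \<in> \<rat>" "s < p" "p < v"
        using Rats_dense_in_real[of s v] v by auto
      have "(p, r) \<in> J" using p r v by (auto simp: J_def)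
      then show ?thesis using p r pick[of p r] by (intro bexI[of _ "pick (p, r)"]) (auto simp: D_def)
    qed
  qed
qed

text \<open>Apply the previous lemma to the sublevel sets of \<open>b\<close> at rational levels and
  take the union. A real level \<open>q\<close> reduces to a rational one, since a rational fits
  strictly between \<open>b s\<close> and \<open>q\<close>.\<close>

lemma countable_right_dense_below:
  fixes b :: "real \<Rightarrow> ereal"
  obtains D where "countable D"
    "\<And>s e q. b s < ereal q \<Longrightarrow> 0 < e \<Longrightarrow> \<exists>u\<in>D. s \<le> u \<and> u < s + e \<and> b u < ereal q"
proof -
  have "\<forall>q. \<exists>D. countable D \<and> D \<subseteq> {s. b s < ereal q} \<and>
      (\<forall>s\<in>{s. b s < ereal q}. \<forall>e>0. \<exists>u\<in>D. s \<le> u \<and> u < s + e)"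
    by (meson countable_right_dense)
  then obtain D where D: "\<And>q. countable (D q)" "\<And>q. D q \<subseteq> {s. b s < ereal q}"
      "\<And>q s e. b s < ereal q \<Longrightarrow> e > 0 \<Longrightarrow> \<exists>u\<in>D q. s \<le> u \<and> u < s + e"
    by (metis mem_Collect_eq)
  show thesis
  proof
    show "countable (\<Union>q\<in>\<rat>. D q)" using D(1) by (auto simp: countable_rat)
    fix s e q assume *: "b s < ereal q" "0 < (e::real)"
    obtain r where "b s < ereal r" "r < q" "r \<in> \<rat>"
    proof -
      obtain x where x: "b s < ereal x" "x < q"
        using *(1) ereal_dense2 by (metis ereal_less(2) less_ereal.simps(1))
      then obtain r where "r \<in> \<rat>" "x < r" "r < q" using Rats_dense_in_real by blast
      then show thesis using that x by (meson less_ereal.simps(1) less_trans)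
    qed
    moreover obtain u where "u \<in> D r" "s \<le> u" "u < s + e" using D(3) calculation * by blast
    moreover have "b u < ereal q" using D(2)[of r] calculation
      by (metis less_ereal.simps(1) less_trans mem_Collect_eq subsetD)
    ultimately show "\<exists>u\<in>(\<Union>q\<in>\<rat>. D q). s \<le> u \<and> u < s + e \<and> b u < ereal q" by blast
  qed
qed

section \<open>Order of distribution functions of finite measures\<close>

lemma downward_closed_real_cases:
  fixes S :: "real set"
  assumes "\<And>x y. x \<in> S \<Longrightarrow> y \<le> x \<Longrightarrow> y \<in> S"
  shows "S = {} \<or> S = UNIV \<or> (\<exists>c. S = {..c} \<or> S = {..<c})"
proof (cases "S = {} \<or> S = UNIV")
  case False
  then obtain z where z: "z \<notin> S" by auto
  have lt: "x < z" if "x \<in> S" for x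
    using assms[OF that, of z] z by fastforce
  then have bdd: "bdd_above S" by (intro bdd_aboveI[of _ z]) (auto intro: less_imp_le)
  have "y \<in> S" if "y < Sup S" for y
    using that less_cSup_iff[of S y] bdd False assms by (meson less_imp_le)
  moreover have "y \<le> Sup S" if "y \<in> S" for y
    using that bdd by (rule cSup_upper)
  ultimately have "S = {..Sup S} \<or> S = {..<Sup S}"
    by (cases "Sup S \<in> S") (auto simp: order_le_less)
  then show ?thesis by blast
qed blast

text \<open>A nonempty downward closed set is a closed half-line or an increasing union of closed
  half-lines, so continuity from below carries the inequality over. The case of the whole line says
  that the total masses are ordered too; they may differ.\<close>

lemma emeasure_downward_closed_le:
  fixes S :: "real set"
  assumes N: "finite_measure N1" "sets N1 = sets borel" "finite_measure N2" "sets N2 = sets borel"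
    and le: "\<And>c. emeasure N1 {..c} \<le> emeasure N2 {..c}"
    and S: "\<And>x y. x \<in> S \<Longrightarrow> y \<le> x \<Longrightarrow> y \<in> S"
  shows "emeasure N1 S \<le> emeasure N2 S"
proof -
  have [simp]: "sets N1 = sets borel" "sets N2 = sets borel" using N by auto
  have lim: "emeasure N1 (\<Union>n. {..a n}) \<le> emeasure N2 (\<Union>n. {..a n})" if "incseq a" for a :: "nat \<Rightarrow> real"
  proof -
    have "incseq (\<lambda>n. {..a n})" using that by (auto simp: incseq_def intro: order_trans)
    then have "(SUP n. emeasure N1 {..a n}) = emeasure N1 (\<Union>n. {..a n})"
      "(SUP n. emeasure N2 {..a n}) = emeasure N2 (\<Union>n. {..a n})"
      by (auto intro!: SUP_emeasure_incseq)
    then show ?thesis using le by (metis SUP_mono' )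
  qed
  consider "S = {}" | "S = UNIV" | c where "S = {..c}" | c where "S = {..<c}"
    using downward_closed_real_cases[of S] S by blast
  then show ?thesis
  proof cases
    case 2
    have "(\<Union>n. {..real n}) = UNIV" using real_arch_simple by auto
    then show ?thesis using lim[of real] 2 by (auto simp: incseq_def)
  next
    case (4 c)
    have "(\<Union>n. {..c - inverse (real (Suc n))}) = {..<c}"
    proof (intro equalityI subsetI)
      fix x assume "x \<in> {..<c}"
      then obtain n where "inverse (real (Suc n)) < c - x" using reals_Archimedean[of "c - x"] by auto
      then show "x \<in> (\<Union>n. {..c - inverse (real (Suc n))})" by (auto intro!: exI[of _ n])
    next
      fix x assume "x \<in> (\<Union>n. {..c - inverse (real (Suc n))})"
      then obtain n where "x \<le> c - inverse (real (Suc n))" by auto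
      moreover have "inverse (real (Suc n)) > 0" by simp
      ultimately show "x \<in> {..<c}" by (simp only: lessThan_iff)
    qed
    moreover have "incseq (\<lambda>n. c - inverse (real (Suc n)))"
      by (intro incseq_SucI) (simp add: le_imp_inverse_le)
    ultimately show ?thesis using lim[of "\<lambda>n. c - inverse (real (Suc n))"] 4 by auto
  qed (simp_all add: le)
qed

text \<open>Layer-cake formula: the integral of \<open>f\<close> is the Lebesgue integral over
  \<open>u\<close> of the mass of the set where \<open>f\<close> exceeds \<open>u\<close>. As
  \<open>f\<close> is antitone, these sets are downward closed.\<close>

lemma nn_integral_antimono_le:
  fixes f :: "real \<Rightarrow> real"
  assumes N: "finite_measure N1" "sets N1 = sets borel" "finite_measure N2" "sets N2 = sets borel"
    and le: "\<And>c. emeasure N1 {..c} \<le> emeasure N2 {..c}"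
    and f: "antimono f" "\<And>x. 0 \<le> f x"
  shows "(\<integral>\<^sup>+x. f x \<partial>N1) \<le> (\<integral>\<^sup>+x. f x \<partial>N2)"
proof -
  have "(\<lambda>x. - f x) \<in> borel_measurable borel"
    using f by (intro borel_measurable_mono) (auto simp: mono_def antimono_def)
  then have [measurable]: "f \<in> borel_measurable borel" by simp
  have layer: "(\<integral>\<^sup>+x. f x \<partial>N) = (\<integral>\<^sup>+u. emeasure N {x. 0 \<le> u \<and> u < f x} \<partial>lborel)"
    if "finite_measure N" and N[measurable_cong]: "sets N = sets borel" for N
  proof -
    interpret N: finite_measure N by fact
    interpret pair_sigma_finite N lborel ..
    have "(\<integral>\<^sup>+x. f x \<partial>N) = (\<integral>\<^sup>+x. \<integral>\<^sup>+u. indicator {u. 0 \<le> u \<and> u < f x} u \<partial>lborel \<partial>N)"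
    proof (intro nn_integral_cong)
      fix x
      have "{u. 0 \<le> u \<and> u < f x} = {0..<f x}" by auto
      then show "ennreal (f x) = (\<integral>\<^sup>+u. indicator {u. 0 \<le> u \<and> u < f x} u \<partial>lborel)"
        using f(2)[of x] by simp
    qed
    also have "\<dots> = (\<integral>\<^sup>+u. \<integral>\<^sup>+x. indicator {x. 0 \<le> u \<and> u < f x} x \<partial>N \<partial>lborel)"
      by (subst Fubini'[symmetric]) (auto simp: indicator_def simp del: nn_integral_indicator intro!: nn_integral_cong)
    also have "\<dots> = (\<integral>\<^sup>+u. emeasure N {x. 0 \<le> u \<and> u < f x} \<partial>lborel)"
      by (intro nn_integral_cong nn_integral_indicator) measurable
    finally show ?thesis .
  qed
  show ?thesis
    unfolding layer[OF N(1,2)] layer[OF N(3,4)]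
  proof (rule nn_integral_mono)
    fix u
    show "emeasure N1 {x. 0 \<le> u \<and> u < f x} \<le> emeasure N2 {x. 0 \<le> u \<and> u < f x}"
    proof (rule emeasure_downward_closed_le[OF N le])
      fix x y assume "x \<in> {x. 0 \<le> u \<and> u < f x}" "y \<le> x"
      then show "y \<in> {x. 0 \<le> u \<and> u < f x}"
        using antimonoD[OF f(1) \<open>y \<le> x\<close>] by simp
    qed
  qed
qed

section \<open>Survival of a path read off from countably many times\<close>

text \<open>Suppose the path respects the boundary on the countable set. A strict crossing at
  \<open>s\<close> before \<open>t\<close> would persist to the right of \<open>s\<close> at some
  level \<open>q\<close> above \<open>b s\<close>, and \<open>D\<close> has a time there with
  boundary below \<open>q\<close>, a contradiction. At \<open>t\<close> the inequality is strict by
  \<open>ne\<close>; right-continuity of the path and lower semicontinuity of \<open>b\<close>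
  extend it beyond \<open>t\<close>.\<close>

lemma tau_greater_iff:
  fixes X :: "real \<Rightarrow> 'w \<Rightarrow> real"
  assumes b: "boundary_function b" and t: "0 < t"
    and D: "\<And>s e q. b (ennreal s) < ereal q \<Longrightarrow> 0 < e \<Longrightarrow>
              \<exists>u\<in>D. s \<le> u \<and> u < s + e \<and> b (ennreal u) < ereal q"
    and rc: "\<forall>t\<ge>0. continuous (at_right t) (\<lambda>s. X s \<omega>)"
    and tau: "tau X b \<omega> = tau' X b \<omega>"
    and ne: "b (ennreal t) \<noteq> ereal (X t \<omega>)"
  shows "ennreal t < tau X b \<omega> \<longleftrightarrow>
         (\<forall>u\<in>insert t (D \<inter> {0<..<t}). ereal (X u \<omega>) \<le> b (ennreal u))"
proof
  assume "ennreal t < tau X b \<omega>"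
  show "\<forall>u\<in>insert t (D \<inter> {0<..<t}). ereal (X u \<omega>) \<le> b (ennreal u)"
  proof (intro ballI, rule ccontr)
    fix u assume u: "u \<in> insert t (D \<inter> {0<..<t})" "\<not> ereal (X u \<omega>) \<le> b (ennreal u)"
    then have "tau X b \<omega> \<le> ennreal u"
      unfolding tau_def using t by (intro INF_lower) auto
    also have "\<dots> \<le> ennreal t" using u by (auto intro: ennreal_leI)
    finally show False using \<open>ennreal t < tau X b \<omega>\<close> by simp
  qed
next
  assume below: "\<forall>u\<in>insert t (D \<inter> {0<..<t}). ereal (X u \<omega>) \<le> b (ennreal u)"
  have right: "\<exists>e>0. \<forall>v. s \<le> v \<longrightarrow> v < s + e \<longrightarrow> X v \<omega> \<in> U" if "0 < s" "open U" "X s \<omega> \<in> U" for s U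
  proof -
    have "((\<lambda>s. X s \<omega>) \<longlongrightarrow> X s \<omega>) (at_right s)"
      using rc \<open>0 < s\<close> by (simp add: continuous_within)
    then have "\<forall>\<^sub>F v in at_right s. X v \<omega> \<in> U" using that by (rule_tac topological_tendstoD)
    then obtain d where "d > s" "\<And>v. s < v \<Longrightarrow> v < d \<Longrightarrow> X v \<omega> \<in> U"
      by (auto simp: eventually_at_right_field)
    then show ?thesis using \<open>X s \<omega> \<in> U\<close> by (intro exI[of _ "d - s"]) (auto simp: order_le_less)
  qed
  have le: "ereal (X s \<omega>) \<le> b (ennreal s)" if s: "0 < s" "s \<le> t" for s
  proof (rule ccontr)
    assume "\<not> ?thesis"
    then have lt: "b (ennreal s) < ereal (X s \<omega>)" by simp
    then have "s < t" using below s by (cases "s = t") auto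
    obtain q where q: "b (ennreal s) < ereal q" "q < X s \<omega>"
      using lt ereal_dense2 by (metis less_ereal.simps(1))
    obtain e where e: "e > 0" "\<And>v. s \<le> v \<Longrightarrow> v < s + e \<Longrightarrow> X v \<omega> \<in> {q<..}"
      using right[OF s(1), of "{q<..}"] q by auto
    \<comment> \<open>The bound \<open>t - s\<close> keeps \<open>u\<close> before \<open>t\<close>,
      hence inside the set of tested times.\<close>
    obtain u where u: "u \<in> D" "s \<le> u" "u < s + min e (t - s)" "b (ennreal u) < ereal q"
      using D[OF q(1), of "min e (t - s)"] e \<open>s < t\<close> by auto
    have "u < s + e" "u < t" using u(3) by (simp_all add: min_def split: if_splits)
    then have "ereal (X u \<omega>) \<le> b (ennreal u)" using u below s by auto
    also have "\<dots> < ereal q" by fact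
    finally have "X u \<omega> < q" by simp
    then show False using e(2)[OF u(2) \<open>u < s + e\<close>] by simp
  qed
  then have "ereal (X t \<omega>) < b (ennreal t)" using ne t by (metis order_le_less order_refl)
  then obtain q where q: "X t \<omega> < q" "ereal q < b (ennreal t)"
    using ereal_dense2 by (metis less_ereal.simps(1))
  obtain e1 where e1: "e1 > 0" "\<And>v. t \<le> v \<Longrightarrow> v < t + e1 \<Longrightarrow> X v \<omega> \<in> {..<q}"
    using right[OF t, of "{..<q}"] q by auto
  have "open (ennreal -` {t. ereal q < b t})"
    using b by (intro continuous_open_vimage) (auto simp: boundary_function_def continuous_on_ennreal)
  then obtain e2 where e2: "e2 > 0" "\<And>v. \<bar>v - t\<bar> < e2 \<Longrightarrow> ereal q < b (ennreal v)"
    using q by (auto simp: open_real)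
  define e where "e = min e1 e2"
  have "ennreal t < ennreal (t + e)" using t e1 e2 by (intro ennreal_lessI) (auto simp: e_def)
  \<comment> \<open>Up to time \<open>t\<close> only the weak inequality is known, which rules out
    strict crossings but not contact with the boundary. So the estimate is for \<open>tau'\<close>,
    and \<open>tau = tau'\<close> transfers it.\<close>
  also have "ennreal (t + e) \<le> tau' X b \<omega>"
    unfolding tau'_def
  proof (intro INF_greatest ennreal_leI)
    fix s assume s: "s \<in> {s. 0 < s \<and> b (ennreal s) < ereal (X s \<omega>)}"
    show "t + e \<le> s"
    proof (rule ccontr)
      assume "\<not> t + e \<le> s"
      moreover have "t < s" using le[of s] s by (auto simp: not_le[symmetric])
      ultimately have "X s \<omega> < q" "ereal q < b (ennreal s)"
        using e1(2)[of s] e2(2)[of s] by (auto simp: e_def)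
      then show False using s by (auto dest: less_trans)
    qed
  qed
  finally show "ennreal t < tau X b \<omega>" by (simp add: tau)
qed

section \<open>Monotone transition kernels\<close>

locale monotone_markov =
  fixes E :: "real set" and M :: "'w measure" and F :: "real \<Rightarrow> 'w measure"
    and X :: "real \<Rightarrow> 'w \<Rightarrow> real" and Px :: "real \<Rightarrow> 'w measure"
  assumes interval: "is_interval E"
    and adapted: "adapted_process M F X"
    and stays: "\<forall>x\<in>E. AE \<omega> in Px x. \<forall>t\<ge>0. X t \<omega> \<in> E"
    and markov: "markov_process E M F X Px"
    and st_mono: "\<forall>\<nu>1 \<nu>2. \<forall>t>0.
               prob_measure_on E \<nu>1 \<and> prob_measure_on E \<nu>2 \<and> st_le \<nu>1 \<nu>2 \<longrightarrow>
               st_le (distr (mixture E M X Px \<nu>1) borel (X t))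
                     (distr (mixture E M X Px \<nu>2) borel (X t))"
begin

abbreviation "PA \<equiv> process_algebra M X"

lemma E_borel [measurable]: "E \<in> sets borel"
  using interval by (intro real_interval_borel_measurable)

lemma X_measurable: "0 \<le> t \<Longrightarrow> X t \<in> borel_measurable (F t)" "0 \<le> t \<Longrightarrow> X t \<in> borel_measurable M"
  using adapted unfolding adapted_process_def by (auto intro: measurable_from_subalg)

lemma space_F: "0 \<le> t \<Longrightarrow> space (F t) = space M"
  using adapted unfolding adapted_process_def subalgebra_def by auto

lemma X_measurable_le: "0 \<le> s \<Longrightarrow> s \<le> t \<Longrightarrow> X s \<in> borel_measurable (F t)"
proof -
  assume st: "0 \<le> s" "s \<le> t"
  then have "subalgebra (F t) (F s)"
    using adapted space_F unfolding adapted_process_def subalgebra_def by auto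
  then show ?thesis using X_measurable(1)[OF st(1)] by (rule measurable_from_subalg)
qed

lemma space_PA: "space PA = space M"
  unfolding process_algebra_def by (rule space_measure_of) auto

lemma sets_PA: "sets PA = sigma_sets (space M) {X t -` B \<inter> space M | t B. 0 \<le> t \<and> B \<in> sets borel}"
  unfolding process_algebra_def by (rule sets_measure_of) auto

lemma subalgebra_PA: "subalgebra M PA"
  unfolding subalgebra_def space_PA sets_PA
  using X_measurable(2) by (auto intro!: sets.sigma_sets_subset)

lemma X_measurable_PA: "0 \<le> t \<Longrightarrow> X t \<in> borel_measurable PA"
  unfolding measurable_def space_PA sets_PA by auto

lemma Px: "x \<in> E \<Longrightarrow> prob_space (Px x)" "x \<in> E \<Longrightarrow> sets (Px x) = sets M"
    "x \<in> E \<Longrightarrow> space (Px x) = space M"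
  using markov unfolding markov_process_def by (auto dest: sets_eq_imp_space_eq)

lemma subalgebra_Px: "x \<in> E \<Longrightarrow> subalgebra (Px x) PA" "x \<in> E \<Longrightarrow> 0 \<le> t \<Longrightarrow> subalgebra (Px x) (F t)"
  using subalgebra_PA adapted Px unfolding subalgebra_def adapted_process_def by auto

abbreviation "law x \<equiv> restr_to_subalg (Px x) PA"

text \<open>Makes \<open>law\<close> a kernel, as needed to compute with the \<open>bind\<close> in
  the mixture. Only the sets of \<open>N\<close> matter, so that the lemma serves both Dirac
  measures and the initial law restricted to \<open>E\<close>.\<close>

lemma law_measurable:
  assumes "sets N = sets (restrict_space borel E)"
  shows "law \<in> N \<rightarrow>\<^sub>M subprob_algebra PA"
proof (rule measurable_subprob_algebra)
  have space: "x \<in> E" if "x \<in> space N" for x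
    using that sets_eq_imp_space_eq[OF assms] by (auto simp: space_restrict_space)
  fix x assume "x \<in> space N"
  then have "x \<in> E" by (rule space)
  then show "sets (law x) = sets PA" by (intro sets_restr_to_subalg subalgebra_Px)
  show "subprob_space (law x)"
    using \<open>x \<in> E\<close> by (intro prob_space_imp_subprob_space prob_space_restr_to_subalg subalgebra_Px Px)
next
  fix A assume A: "A \<in> sets PA"
  then have "(\<lambda>x. measure (Px x) A) \<in> borel_measurable (restrict_space borel E)"
    using markov unfolding markov_process_def by auto
  then have "(\<lambda>x. ennreal (measure (Px x) A)) \<in> borel_measurable N"
    using assms by (simp cong: measurable_cong_sets)
  moreover have "ennreal (measure (Px x) A) = emeasure (law x) A" if "x \<in> space N" for x
  proof -
    have "x \<in> E" using that sets_eq_imp_space_eq[OF assms] by (auto simp: space_restrict_space)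
    then interpret prob_space "Px x" by (rule Px)
    show ?thesis using A \<open>x \<in> E\<close> by (simp add: emeasure_restr_to_subalg subalgebra_Px emeasure_eq_measure)
  qed
  ultimately show "(\<lambda>x. emeasure (law x) A) \<in> borel_measurable N"
    by (simp cong: measurable_cong)
qed

lemma mixture_return: "x \<in> E \<Longrightarrow> mixture E M X Px (return borel x) = law x"
  unfolding mixture_def return_restrict_space[OF E_borel, symmetric]
  by (rule bind_return[where N = PA]) (auto intro!: law_measurable simp: space_restrict_space)

text \<open>The intersection with \<open>E\<close> matches the Markov property, which speaks only of
  Borel subsets of \<open>E\<close>. For \<open>x\<close> in \<open>E\<close> it changes the event
  by a null set only.\<close>

definition trans_cdf :: "real \<Rightarrow> real \<Rightarrow> real \<Rightarrow> real" where
  "trans_cdf s c x = measure (Px x) {\<omega> \<in> space M. X s \<omega> \<in> {..c} \<inter> E}"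

text \<open>Stochastic monotonicity applied to the Dirac measures at \<open>x\<close> and
  \<open>y\<close>, whose mixtures are \<open>law x\<close> and \<open>law y\<close>.\<close>

lemma trans_cdf_antimono:
  assumes "x \<in> E" "y \<in> E" "x \<le> y" "0 < s"
  shows "trans_cdf s c y \<le> trans_cdf s c x"
proof -
  have on: "prob_measure_on E (return borel z)" if "z \<in> E" for z
    using that by (auto simp: prob_measure_on_def prob_space_return)
  have "st_le (return borel x) (return borel y)"
    using \<open>x \<le> y\<close> by (auto simp: st_le_def measure_return split: split_indicator)
  then have "st_le (distr (law x) borel (X s)) (distr (law y) borel (X s))"
    using st_mono on assms mixture_return by metis
  moreover have "measure (distr (law z) borel (X s)) {..c} = trans_cdf s c z" if z: "z \<in> E" for z
  proof -
    have [measurable]: "X s \<in> borel_measurable PA" using \<open>0 < s\<close> by (intro X_measurable_PA) simp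
    have X: "X s \<in> borel_measurable (law z)"
      using z \<open>0 < s\<close> by (intro measurable_in_subalg subalgebra_Px X_measurable_PA) auto
    have XP [measurable]: "X s \<in> borel_measurable (Px z)"
      using z \<open>0 < s\<close> by (intro measurable_from_subalg[OF subalgebra_Px(1)] X_measurable_PA) auto
    have "emeasure (distr (law z) borel (X s)) {..c} = emeasure (law z) (X s -` {..c} \<inter> space (law z))"
      using X by (rule emeasure_distr) simp
    also have "\<dots> = emeasure (Px z) (X s -` {..c} \<inter> space M)"
      using measurable_sets[of "X s" PA borel "{..c}"]
      by (simp add: emeasure_restr_to_subalg[OF subalgebra_Px(1)[OF z]] space_restr_to_subalg Px[OF z] space_PA)
    also have "\<dots> = emeasure (Px z) {\<omega> \<in> space M. X s \<omega> \<in> {..c} \<inter> E}"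
    proof (rule emeasure_eq_AE)
      show "AE \<omega> in Px z. (\<omega> \<in> X s -` {..c} \<inter> space M) = (\<omega> \<in> {\<omega> \<in> space M. X s \<omega> \<in> {..c} \<inter> E})"
        using stays z \<open>0 < s\<close> by (auto elim!: eventually_mono)
    qed (unfold Px(3)[OF z, symmetric], measurable)
    finally show ?thesis by (simp add: measure_def trans_cdf_def)
  qed
  ultimately show ?thesis using assms unfolding st_le_def by metis
qed

text \<open>The \<open>0\<close> keeps the supremum meaningful to the right of \<open>E\<close>; outside \<open>E\<close> only monotonicity matters.\<close>

definition trans_cdf_ext :: "real \<Rightarrow> real \<Rightarrow> real \<Rightarrow> real" where
  "trans_cdf_ext s c y = Sup (insert 0 (trans_cdf s c ` (E \<inter> {y..})))"

lemma trans_cdf_le_1: "x \<in> E \<Longrightarrow> trans_cdf s c x \<le> 1"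
  unfolding trans_cdf_def by (intro prob_space.prob_le_1 Px)

lemma trans_cdf_ext_bdd: "bdd_above (insert 0 (trans_cdf s c ` (E \<inter> {y..})))"
  by (rule bdd_aboveI[of _ 1]) (auto simp: trans_cdf_le_1)

lemma trans_cdf_ext_nonneg: "0 \<le> trans_cdf_ext s c y"
  unfolding trans_cdf_ext_def by (intro cSup_upper trans_cdf_ext_bdd) simp

lemma trans_cdf_ext_antimono: "antimono (trans_cdf_ext s c)"
  unfolding trans_cdf_ext_def
  by (intro antimonoI cSup_subset_mono trans_cdf_ext_bdd) auto

lemma trans_cdf_ext_measurable [measurable]: "trans_cdf_ext s c \<in> borel_measurable borel"
proof -
  have "(\<lambda>x. - trans_cdf_ext s c x) \<in> borel_measurable borel"
    using antimonoD[OF trans_cdf_ext_antimono] by (intro borel_measurable_mono) (auto simp: mono_def)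
  then show ?thesis by simp
qed

lemma trans_cdf_ext_eq: "x \<in> E \<Longrightarrow> 0 < s \<Longrightarrow> trans_cdf_ext s c x = trans_cdf s c x"
  unfolding trans_cdf_ext_def
  by (rule cSup_eq_maximum) (auto intro: trans_cdf_antimono, simp add: trans_cdf_def)

text \<open>The Markov property integrated over an event of \<open>F s\<close>. In this form it
  contains no conditional expectation and can be integrated over the starting point.\<close>

lemma markov_Px:
  assumes x: "x \<in> E" and A: "A \<in> sets (F s)" and s: "0 \<le> s" "s < r"
  shows "emeasure (Px x) {\<omega> \<in> A. X r \<omega> \<in> {..c} \<inter> E} =
         (\<integral>\<^sup>+\<omega>. indicator A \<omega> * ennreal (trans_cdf_ext (r - s) c (X s \<omega>)) \<partial>Px x)"
proof -
  interpret prob_space "Px x" using x by (rule Px)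
  interpret finite_measure_subalgebra "Px x" "F s"
    by unfold_locales (rule subalgebra_Px(2)[OF x s(1)])
  define B where "B = {..c} \<inter> E"
  have [measurable]: "B \<in> sets borel" by (simp add: B_def)
  have [measurable]: "X s \<in> borel_measurable (Px x)" "X r \<in> borel_measurable (Px x)"
    using X_measurable(2)[of s] X_measurable(2)[of r] s Px[OF x] by (auto cong: measurable_cong_sets)
  have A' [measurable]: "A \<in> sets (Px x)" using A subalg by (auto simp: subalgebra_def)
  have "(\<lambda>\<omega>. indicator B (X r \<omega>) :: real) \<in> borel_measurable (Px x)" by measurable
  then have int: "integrable (Px x) (\<lambda>\<omega>. indicator B (X r \<omega>) :: real)"
    by (intro integrable_const_bound[where B = 1]) auto
  have "AE \<omega> in Px x. real_cond_exp (Px x) (F s) (\<lambda>\<omega>. indicator B (X r \<omega>)) \<omega> = trans_cdf (r - s) c (X s \<omega>)"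
  proof -
    have "B \<subseteq> E" by (simp add: B_def)
    then show ?thesis
      using markov[unfolded markov_process_def, THEN conjunct2, THEN conjunct2, THEN conjunct2,
          rule_format, of x "r - s" s B] x s by (simp add: trans_cdf_def B_def)
  qed
  \<comment> \<open>\<open>trans_cdf\<close> is controlled only at points of \<open>E\<close>. Since
    \<open>X s\<close> stays there almost surely, it can be replaced by its extension, which is
    Borel on the whole line.\<close>
  moreover have "AE \<omega> in Px x. X s \<omega> \<in> E" using stays x s by (auto elim: eventually_mono)
  ultimately have ae: "AE \<omega> in Px x. real_cond_exp (Px x) (F s) (\<lambda>\<omega>. indicator B (X r \<omega>)) \<omega> =
      trans_cdf_ext (r - s) c (X s \<omega>)"
    by eventually_elim (use s in \<open>simp add: trans_cdf_ext_eq\<close>)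
  have le1: "trans_cdf_ext t c y \<le> 1" for t y
    unfolding trans_cdf_ext_def by (rule cSup_least) (auto simp: trans_cdf_le_1)
  have "measure (Px x) {\<omega> \<in> A. X r \<omega> \<in> B} = (\<integral>\<omega>. indicator {\<omega> \<in> A. X r \<omega> \<in> B} \<omega> \<partial>Px x)"
  proof -
    have "{\<omega> \<in> A. X r \<omega> \<in> B} = A \<inter> (X r -` B \<inter> space (Px x))"
      using sets.sets_into_space[OF A'] by auto
    also have "\<dots> \<in> sets (Px x)" by measurable
    finally show ?thesis by simp
  qed
  also have "\<dots> = (\<integral>\<omega>\<in>A. indicator B (X r \<omega>) \<partial>Px x)"
    unfolding set_lebesgue_integral_def by (intro Bochner_Integration.integral_cong) (auto simp: indicator_def)
  also have "\<dots> = (\<integral>\<omega>\<in>A. real_cond_exp (Px x) (F s) (\<lambda>\<omega>. indicator B (X r \<omega>)) \<omega> \<partial>Px x)"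
    using int A by (rule real_cond_exp_intA)
  also have "\<dots> = (\<integral>\<omega>. indicator A \<omega> * trans_cdf_ext (r - s) c (X s \<omega>) \<partial>Px x)"
    unfolding set_lebesgue_integral_def using ae
    by (intro integral_cong_AE) (auto elim: eventually_mono)
  finally have "ennreal (measure (Px x) {\<omega> \<in> A. X r \<omega> \<in> B}) =
      ennreal (\<integral>\<omega>. indicator A \<omega> * trans_cdf_ext (r - s) c (X s \<omega>) \<partial>Px x)" by simp
  also have "\<dots> = (\<integral>\<^sup>+\<omega>. ennreal (indicator A \<omega> * trans_cdf_ext (r - s) c (X s \<omega>)) \<partial>Px x)"
    by (rule nn_integral_eq_integral[symmetric])
      (auto intro!: integrable_const_bound[where B = 1] simp: trans_cdf_ext_nonneg le1 split: split_indicator)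
  also have "\<dots> = (\<integral>\<^sup>+\<omega>. indicator A \<omega> * ennreal (trans_cdf_ext (r - s) c (X s \<omega>)) \<partial>Px x)"
    by (intro nn_integral_cong) (auto split: split_indicator)
  finally show ?thesis by (simp add: emeasure_eq_measure B_def)
qed

end

section \<open>The process under its initial law\<close>

locale monotone_markov_law = monotone_markov E M F X Px
  for E :: "real set" and M :: "'w measure" and F X Px +
  fixes \<mu> :: "real measure" and Q P :: "'w measure"
  assumes initial: "prob_measure_on E \<mu>"
    and mixture: "mixture_law E M X Px \<mu> Q"
    and P_eq: "P = completion Q"
begin

lemma Q: "prob_space Q" "sets Q = sets M" "space Q = space M"
    "restr_to_subalg Q PA = restrict_space \<mu> E \<bind> law"
  using mixture unfolding mixture_law_def mixture_def by (auto dest: sets_eq_imp_space_eq)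

sublocale P: prob_space P
proof
  interpret prob_space Q by (rule Q)
  show "emeasure P (space P) = 1" unfolding P_eq by (simp add: emeasure_space_1)
qed

lemma space_P: "space P = space M"
  by (simp add: P_eq Q)

lemma sets_P: "A \<in> sets M \<Longrightarrow> A \<in> sets P"
  by (simp add: P_eq Q sets_completionI_sets)

lemma emeasure_P: "A \<in> sets M \<Longrightarrow> emeasure P A = emeasure Q A"
  by (simp add: P_eq Q)

lemma X_measurable_P: "0 \<le> t \<Longrightarrow> X t \<in> borel_measurable P"
  unfolding P_eq using X_measurable(2)[of t] by (intro measurable_completion) (simp cong: measurable_cong_sets add: Q)

lemma initial_space: "sets (restrict_space \<mu> E) = sets (restrict_space borel E)"
    "space (restrict_space \<mu> E) = E" "E \<noteq> {}"
proof -
  have \<mu>: "sets \<mu> = sets borel" "emeasure \<mu> E = 1" using initial by (auto simp: prob_measure_on_def)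
  show "sets (restrict_space \<mu> E) = sets (restrict_space borel E)"
    using \<mu>(1) by (rule sets_restrict_space_cong)
  show "space (restrict_space \<mu> E) = E"
    using sets_eq_imp_space_eq[OF \<mu>(1)] by (simp add: space_restrict_space)
  show "E \<noteq> {}" using \<mu>(2) by auto
qed

text \<open>The mixture formula describes \<open>Q\<close> on \<open>PA\<close> only, hence the
  measurability asked of \<open>g\<close>.\<close>

lemma nn_integral_Q:
  assumes g: "g \<in> borel_measurable PA"
  shows "(\<integral>\<^sup>+\<omega>. g \<omega> \<partial>Q) = (\<integral>\<^sup>+x. \<integral>\<^sup>+\<omega>. g \<omega> \<partial>Px x \<partial>restrict_space \<mu> E)"
proof -
  have "subalgebra Q PA" using subalgebra_PA by (simp add: subalgebra_def Q)
  then have "(\<integral>\<^sup>+\<omega>. g \<omega> \<partial>Q) = (\<integral>\<^sup>+\<omega>. g \<omega> \<partial>(restrict_space \<mu> E \<bind> law))"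
    using g unfolding Q(4)[symmetric] by (rule nn_integral_subalgebra2[symmetric])
  also have "\<dots> = (\<integral>\<^sup>+x. \<integral>\<^sup>+\<omega>. g \<omega> \<partial>law x \<partial>restrict_space \<mu> E)"
    using g by (rule nn_integral_bind) (rule law_measurable[OF initial_space(1)])
  also have "\<dots> = (\<integral>\<^sup>+x. \<integral>\<^sup>+\<omega>. g \<omega> \<partial>Px x \<partial>restrict_space \<mu> E)"
    using g by (intro nn_integral_cong nn_integral_subalgebra2 subalgebra_Px) (auto simp: initial_space)
  finally show ?thesis .
qed

lemma X_le_sets:
  assumes "A \<in> sets N" "X r \<in> borel_measurable N"
  shows "{\<omega> \<in> A. X r \<omega> \<le> c} \<in> sets N"
proof -
  have "{\<omega> \<in> A. X r \<omega> \<le> c} = A \<inter> {\<omega> \<in> space N. X r \<omega> \<le> c}"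
    using sets.sets_into_space[OF assms(1)] by auto
  also have "\<dots> \<in> sets N" using assms by measurable
  finally show ?thesis .
qed

text \<open>Integrate \<open>markov_Px\<close> over the starting point. The event has to lie in
  \<open>F s\<close> for the Markov property under each \<open>Px x\<close>, and in
  \<open>PA\<close> for the passage to \<open>Q\<close> through the mixture.\<close>

lemma markov_Q:
  assumes A: "A \<in> sets PA" "A \<in> sets (F s)" and s: "0 \<le> s" "s < r"
  shows "emeasure Q {\<omega> \<in> A. X r \<omega> \<le> c} =
         (\<integral>\<^sup>+\<omega>. indicator A \<omega> * ennreal (trans_cdf_ext (r - s) c (X s \<omega>)) \<partial>Q)"
proof -
  have [measurable]: "X s \<in> borel_measurable PA" "X r \<in> borel_measurable PA" "A \<in> sets PA"
    using X_measurable_PA A s by auto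
  have B [measurable]: "{\<omega> \<in> A. X r \<omega> \<le> c} \<in> sets PA" by (rule X_le_sets) measurable
  have BQ: "{\<omega> \<in> A. X r \<omega> \<le> c} \<in> sets N" if "subalgebra N PA" for N
    using B that by (auto simp: subalgebra_def)
  have "emeasure Q {\<omega> \<in> A. X r \<omega> \<le> c} = (\<integral>\<^sup>+\<omega>. indicator {\<omega> \<in> A. X r \<omega> \<le> c} \<omega> \<partial>Q)"
    using BQ[OF subalgebra_PA] by (subst nn_integral_indicator) (auto simp: Q)
  also have "\<dots> = (\<integral>\<^sup>+x. emeasure (Px x) {\<omega> \<in> A. X r \<omega> \<le> c} \<partial>restrict_space \<mu> E)"
    using BQ by (subst nn_integral_Q) (auto intro!: nn_integral_cong simp: initial_space subalgebra_Px)
  also have "\<dots> = (\<integral>\<^sup>+x. \<integral>\<^sup>+\<omega>. indicator A \<omega> * ennreal (trans_cdf_ext (r - s) c (X s \<omega>)) \<partial>Px x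
                     \<partial>restrict_space \<mu> E)"
  proof (intro nn_integral_cong)
    fix x assume "x \<in> space (restrict_space \<mu> E)"
    then have x: "x \<in> E" by (simp add: initial_space)
    have "{\<omega> \<in> A. X r \<omega> \<in> {..c} \<inter> E} = A \<inter> X r -` ({..c} \<inter> E) \<inter> space PA"
      using sets.sets_into_space[OF A(1)] by auto
    also have "\<dots> \<in> sets PA" by measurable
    finally have "{\<omega> \<in> A. X r \<omega> \<in> {..c} \<inter> E} \<in> sets (Px x)"
      using subalgebra_Px(1)[OF x] by (auto simp: subalgebra_def)
    moreover have "AE \<omega> in Px x. X r \<omega> \<in> E" using stays x s by (auto elim: eventually_mono)
    then have "AE \<omega> in Px x. (\<omega> \<in> {\<omega> \<in> A. X r \<omega> \<le> c}) = (\<omega> \<in> {\<omega> \<in> A. X r \<omega> \<in> {..c} \<inter> E})"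
      by (auto elim: eventually_mono)
    ultimately have "emeasure (Px x) {\<omega> \<in> A. X r \<omega> \<le> c} = emeasure (Px x) {\<omega> \<in> A. X r \<omega> \<in> {..c} \<inter> E}"
      using BQ[OF subalgebra_Px(1)[OF x]] by (intro emeasure_eq_AE)
    also have "\<dots> = (\<integral>\<^sup>+\<omega>. indicator A \<omega> * ennreal (trans_cdf_ext (r - s) c (X s \<omega>)) \<partial>Px x)"
      by (rule markov_Px) fact+
    finally show "emeasure (Px x) {\<omega> \<in> A. X r \<omega> \<le> c} =
        (\<integral>\<^sup>+\<omega>. indicator A \<omega> * ennreal (trans_cdf_ext (r - s) c (X s \<omega>)) \<partial>Px x)" .
  qed
  also have "\<dots> = (\<integral>\<^sup>+\<omega>. indicator A \<omega> * ennreal (trans_cdf_ext (r - s) c (X s \<omega>)) \<partial>Q)"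
    by (rule nn_integral_Q[symmetric]) measurable
  finally show ?thesis .
qed

text \<open>At time \<open>r\<close> both sides are integrals of the same antitone function
  \<open>trans_cdf_ext (r - s) c\<close>, taken against the unnormalised laws \<open>N A\<close> and
  \<open>N A'\<close> of \<open>X s\<close> on the two events. The order of their distribution
  functions therefore passes from \<open>s\<close> to \<open>r\<close>.\<close>

lemma markov_comparison:
  assumes A: "A \<in> sets PA" "A \<in> sets (F s)" and A': "A' \<in> sets PA" "A' \<in> sets (F s)"
    and s: "0 \<le> s" "s < r"
    and le: "\<And>c. emeasure P {\<omega> \<in> A. X s \<omega> \<le> c} \<le> emeasure P {\<omega> \<in> A'. X s \<omega> \<le> c}"
  shows "emeasure P {\<omega> \<in> A. X r \<omega> \<le> c} \<le> emeasure P {\<omega> \<in> A'. X r \<omega> \<le> c}"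
proof -
  interpret Q: prob_space Q by (rule Q)
  have [measurable]: "X s \<in> borel_measurable Q" "X r \<in> borel_measurable Q"
    using X_measurable(2)[of s] X_measurable(2)[of r] s Q(2) by (auto cong: measurable_cong_sets)
  define N where "N B = distr (density Q (indicator B)) borel (X s)" for B
  have sets_Q: "B \<in> sets Q" if "B \<in> sets PA" for B
    using that subalgebra_PA Q(2) by (auto simp: subalgebra_def)
  have N: "finite_measure (N B)" "sets (N B) = sets borel"
    and N_le: "emeasure (N B) {..c} = emeasure P {\<omega> \<in> B. X s \<omega> \<le> c}"
    and N_int: "(\<integral>\<^sup>+x. trans_cdf_ext (r - s) d x \<partial>N B) =
      (\<integral>\<^sup>+\<omega>. indicator B \<omega> * ennreal (trans_cdf_ext (r - s) d (X s \<omega>)) \<partial>Q)"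
    if "B \<in> sets PA" for B c d
  proof -
    have B [measurable]: "B \<in> sets Q" using that by (rule sets_Q)
    show "finite_measure (N B)"
      by (rule finite_measureI) (simp add: N_def emeasure_distr emeasure_density Q.emeasure_eq_measure)
    show "sets (N B) = sets borel" by (simp add: N_def)
    have "X s -` {..c} \<inter> space Q \<inter> B = {\<omega> \<in> B. X s \<omega> \<le> c}"
      using sets.sets_into_space[OF B] by auto
    moreover have "{\<omega> \<in> B. X s \<omega> \<le> c} \<in> sets M" using X_le_sets[OF B, of s c] by (simp add: Q)
    moreover have "emeasure (N B) {..c} = emeasure Q (X s -` {..c} \<inter> space Q \<inter> B)"
      by (simp add: N_def emeasure_distr emeasure_density Q.emeasure_eq_measure flip: indicator_inter_arith)
         (simp add: Int_ac)
    ultimately show "emeasure (N B) {..c} = emeasure P {\<omega> \<in> B. X s \<omega> \<le> c}"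
      by (simp add: emeasure_P)
    show "(\<integral>\<^sup>+x. trans_cdf_ext (r - s) d x \<partial>N B) =
      (\<integral>\<^sup>+\<omega>. indicator B \<omega> * ennreal (trans_cdf_ext (r - s) d (X s \<omega>)) \<partial>Q)"
      by (simp add: N_def nn_integral_distr nn_integral_density)
  qed
  have "(\<integral>\<^sup>+x. trans_cdf_ext (r - s) c x \<partial>N A) \<le> (\<integral>\<^sup>+x. trans_cdf_ext (r - s) c x \<partial>N A')"
    by (rule nn_integral_antimono_le)
      (simp_all add: N N_le A A' le trans_cdf_ext_antimono trans_cdf_ext_nonneg)
  moreover have "emeasure P {\<omega> \<in> B. X r \<omega> \<le> c} = emeasure Q {\<omega> \<in> B. X r \<omega> \<le> c}" if "B \<in> sets PA" for B
    using X_le_sets[OF sets_Q[OF that], of r c] by (simp add: emeasure_P Q)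
  ultimately show ?thesis
    by (simp add: A A' N_int markov_Q[OF A s] markov_Q[OF A' s])
qed

section \<open>Comparison along finitely many times\<close>

definition below :: "(real \<Rightarrow> ereal) \<Rightarrow> real set \<Rightarrow> 'w set" where
  "below \<beta> S = {\<omega> \<in> space M. \<forall>u\<in>S. ereal (X u \<omega>) \<le> \<beta> u}"

lemma below_sets:
  assumes "countable S" "S \<subseteq> {0..s}"
  shows "below \<beta> S \<in> sets PA" "0 \<le> s \<Longrightarrow> below \<beta> S \<in> sets (F s)" "below \<beta> S \<in> sets M"
proof -
  have *: "below \<beta> S \<in> sets N" if space: "space N = space M"
      and meas: "\<And>u. u \<in> S \<Longrightarrow> X u \<in> borel_measurable N" for N
  proof -
    have "{\<omega> \<in> space N. ereal (X u \<omega>) \<le> \<beta> u} \<in> sets N" if "u \<in> S" for u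
    proof -
      have [measurable]: "X u \<in> borel_measurable N" by (rule meas[OF that])
      show ?thesis by measurable
    qed
    then have "S \<noteq> {} \<Longrightarrow> (\<Inter>u\<in>S. {\<omega> \<in> space N. ereal (X u \<omega>) \<le> \<beta> u}) \<in> sets N"
      using assms(1) by (intro sets.countable_INT') auto
    \<comment> \<open>The empty set of times is treated apart, because an intersection over an empty
      index set is not the space of \<open>N\<close>.\<close>
    moreover have "below \<beta> S = (if S = {} then space N else (\<Inter>u\<in>S. {\<omega> \<in> space N. ereal (X u \<omega>) \<le> \<beta> u}))"
      by (auto simp: below_def space)
    ultimately show ?thesis by simp
  qed
  have S: "0 \<le> u" "u \<le> s" if "u \<in> S" for u
    using assms(2) that by auto
  show "below \<beta> S \<in> sets PA"
    by (intro * X_measurable_PA S) (simp_all add: space_PA)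
  then show "below \<beta> S \<in> sets M" using subalgebra_PA by (auto simp: subalgebra_def)
  show "below \<beta> S \<in> sets (F s)" if "0 \<le> s"
    using that by (intro * X_measurable_le S) (simp_all add: space_F)
qed

text \<open>\<open>G s\<close> plays the survival event up to \<open>s\<close> for the other
  boundary. It is only known to lie in the completed \<sigma>-algebra, so \<open>adapt\<close>
  provides a version to which the Markov comparison applies. The induction removes the largest time
  of the set; \<open>s\<close> stays arbitrary because the hypothesis is used at that largest
  time.\<close>

lemma survival_cdf_le_below:
  assumes G: "\<And>s. G s \<in> sets P" "\<And>s r. s \<le> r \<Longrightarrow> G r \<subseteq> G s"
    and adapt: "\<And>s. 0 < s \<Longrightarrow> \<exists>A \<in> sets PA \<inter> sets (F s). AE \<omega> in P. \<omega> \<in> G s \<longleftrightarrow> \<omega> \<in> A"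
    and mass: "\<And>s S. 0 < s \<Longrightarrow> finite S \<Longrightarrow> S \<subseteq> {0<..s} \<Longrightarrow> emeasure P (G s) \<le> emeasure P (below \<beta> S)"
    and S: "finite S" "S \<subseteq> {0<..s}" and s: "0 < s"
  shows "emeasure P {\<omega> \<in> G s. X s \<omega> \<le> c} \<le> emeasure P {\<omega> \<in> below \<beta> S. X s \<omega> \<le> c}"
  using S s
proof (induction S arbitrary: s c rule: finite_linorder_max_induct)
  case empty
  have "{\<omega> \<in> below \<beta> {}. X s \<omega> \<le> c} \<in> sets P"
    using empty below_sets(3)[of "{}" s] by (intro X_le_sets sets_P X_measurable_P) auto
  moreover have "{\<omega> \<in> G s. X s \<omega> \<le> c} \<subseteq> {\<omega> \<in> below \<beta> {}. X s \<omega> \<le> c}"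
    using sets.sets_into_space[OF G(1)[of s]] by (auto simp: below_def space_P)
  ultimately show ?case by (intro emeasure_mono)
next
  case (insert b S)
  have S: "0 < u" "0 \<le> u" "u \<le> b" if "u \<in> S" for u
    using insert that by (auto intro: less_imp_le)
  have b: "0 < b" "b \<le> s" "finite (insert b S)" "insert b S \<subseteq> {0<..b}" "insert b S \<subseteq> {0..b}" "countable (insert b S)"
    using insert S by (auto intro: countable_finite)
  have at_b: "emeasure P {\<omega> \<in> G b. X b \<omega> \<le> c} \<le> emeasure P {\<omega> \<in> below \<beta> (insert b S). X b \<omega> \<le> c}" for c
  \<comment> \<open>Below the level \<open>\<beta> b\<close> the cut at time \<open>b\<close> is
    invisible and the induction hypothesis applies. Above it the right side has reached its full
    mass, and \<open>mass\<close> gives the bound.\<close>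
  proof (cases "ereal c \<le> \<beta> b")
    case True
    then have "{\<omega> \<in> below \<beta> (insert b S). X b \<omega> \<le> c} = {\<omega> \<in> below \<beta> S. X b \<omega> \<le> c}"
      by (auto simp: below_def intro: order_trans[of _ "ereal c"])
    then show ?thesis using insert.IH[of b c] b by auto
  next
    case False
    then have "{\<omega> \<in> below \<beta> (insert b S). X b \<omega> \<le> c} = below \<beta> (insert b S)"
      by (auto simp: below_def dest: order.strict_trans1)
         (metis ereal_less_eq(3) le_cases order_trans)
    moreover have "emeasure P {\<omega> \<in> G b. X b \<omega> \<le> c} \<le> emeasure P (G b)"
      using G(1) by (intro emeasure_mono) auto
    ultimately show ?thesis using mass[OF b(1,3,4)] by simp
  qed
  show ?case
  proof (cases "s = b")
    case False
    then have "b < s" using b by simp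
    obtain A where A: "A \<in> sets PA" "A \<in> sets (F b)" "AE \<omega> in P. \<omega> \<in> G b \<longleftrightarrow> \<omega> \<in> A"
      using adapt[OF b(1)] by auto
    have AM: "A \<in> sets M" using A(1) subalgebra_PA by (auto simp: subalgebra_def)
    have GA: "emeasure P {\<omega> \<in> G b. X r \<omega> \<le> d} = emeasure P {\<omega> \<in> A. X r \<omega> \<le> d}" if "0 \<le> r" for r d
      using A(3) G(1) sets_P[OF AM] that
      by (intro emeasure_eq_AE X_le_sets X_measurable_P) (auto elim: eventually_mono)
    \<comment> \<open>Killing of \<open>G\<close> between \<open>b\<close> and \<open>s\<close> is
      ignored, which only enlarges the left side; from \<open>b\<close> to \<open>s\<close> both
      events then evolve by the kernel alone.\<close>
    have "emeasure P {\<omega> \<in> G s. X s \<omega> \<le> c} \<le> emeasure P {\<omega> \<in> G b. X s \<omega> \<le> c}"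
      using G(1) G(2)[OF b(2)] insert.prems
      by (intro emeasure_mono X_le_sets X_measurable_P) auto
    also have "\<dots> = emeasure P {\<omega> \<in> A. X s \<omega> \<le> c}" using insert.prems by (intro GA) simp
    also have "\<dots> \<le> emeasure P {\<omega> \<in> below \<beta> (insert b S). X s \<omega> \<le> c}"
    proof (rule markov_comparison[OF A(1,2) below_sets(1,2)[OF b(6,5)] _ \<open>b < s\<close>])
      show "emeasure P {\<omega> \<in> A. X b \<omega> \<le> c} \<le> emeasure P {\<omega> \<in> below \<beta> (insert b S). X b \<omega> \<le> c}" for c
        using at_b[of c] GA[of b c] b(1) by simp
    qed (use b in auto)
    finally show ?thesis .
  qed (use at_b in simp)
qed

section \<open>Survival events as limits of finite tests\<close>

text \<open>These are the times tested in \<open>tau_greater_iff\<close>. The time \<open>t\<close>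
  is added by hand since \<open>D\<close> need not contain it; this also makes the set nonempty, as
  its enumeration by \<open>from_nat_into\<close> requires.\<close>

definition past :: "real set \<Rightarrow> real \<Rightarrow> real set" where
  "past D t = insert t (D \<inter> {0<..<t})"

lemma past: "countable D \<Longrightarrow> countable (past D t)" "0 < t \<Longrightarrow> past D t \<subseteq> {0<..t}" "past D t \<noteq> {}"
  by (auto simp: past_def)

lemma passage_subset_below:
  assumes "S \<subseteq> {0<..s}"
  shows "{\<omega> \<in> space P. ennreal s < tau X b \<omega>} \<subseteq> below (\<lambda>u. b (ennreal u)) S"
proof
  fix \<omega> assume \<omega>: "\<omega> \<in> {\<omega> \<in> space P. ennreal s < tau X b \<omega>}"
  have "ereal (X u \<omega>) \<le> b (ennreal u)" if "u \<in> S" for u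
  proof (rule ccontr)
    assume "\<not> ereal (X u \<omega>) \<le> b (ennreal u)"
    then have "tau X b \<omega> \<le> ennreal u"
      unfolding tau_def using that assms by (intro INF_lower) auto
    also have "\<dots> \<le> ennreal s" using that assms by (auto intro: ennreal_leI)
    finally show False using \<omega> by (auto dest: leD)
  qed
  then show "\<omega> \<in> below (\<lambda>u. b (ennreal u)) S" using \<omega> by (simp add: below_def space_P)
qed

text \<open>\<open>tau_greater_iff\<close> up to null sets; diffuseness excludes that
  \<open>X t\<close> hits the single value \<open>b t\<close>. The set \<open>D\<close> is built
  from \<open>b\<close> alone, so one choice serves all \<open>t\<close>.\<close>

lemma passage_AE_below:
  assumes "\<forall>t>0. diffuse (distr P borel (X t))" "right_continuous_paths P X"
    and E3: "\<forall>b. boundary_function b \<longrightarrow> (AE \<omega> in P. tau X b \<omega> = tau' X b \<omega>)"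
    and b: "boundary_function b"
  obtains D where "countable D"
    "\<And>t. 0 < t \<Longrightarrow> AE \<omega> in P. \<omega> \<in> {\<omega> \<in> space P. ennreal t < tau X b \<omega>} \<longleftrightarrow>
       \<omega> \<in> below (\<lambda>u. b (ennreal u)) (past D t)"
proof -
  obtain D where D: "countable D"
    "\<And>s e q. b (ennreal s) < ereal q \<Longrightarrow> 0 < e \<Longrightarrow> \<exists>u\<in>D. s \<le> u \<and> u < s + e \<and> b (ennreal u) < ereal q"
    using countable_right_dense_below[of "\<lambda>s. b (ennreal s)"] by metis
  have "AE \<omega> in P. \<omega> \<in> {\<omega> \<in> space P. ennreal t < tau X b \<omega>} \<longleftrightarrow>
       \<omega> \<in> below (\<lambda>u. b (ennreal u)) (past D t)" if t: "0 < t" for t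
  proof -
    have [measurable]: "X t \<in> borel_measurable P" using t by (intro X_measurable_P) simp
    have "AE \<omega> in P. b (ennreal t) \<noteq> ereal (X t \<omega>)"
    proof (cases "b (ennreal t)")
      case (real x)
      have "emeasure (distr P borel (X t)) {x} = 0"
        using assms(1) t by (simp add: diffuse_def)
      then have "emeasure P {\<omega> \<in> space P. X t \<omega> = x} = 0"
        by (simp add: emeasure_distr vimage_def Int_def conj_commute)
      then have "AE \<omega> in P. X t \<omega> \<noteq> x"
        by (subst AE_iff_measurable[OF _ refl]) auto
      then show ?thesis using real by (auto elim: eventually_mono)
    qed auto
    moreover have "AE \<omega> in P. tau X b \<omega> = tau' X b \<omega>" using E3 b by blast
    moreover have "AE \<omega> in P. \<forall>t\<ge>0. continuous (at_right t) (\<lambda>s. X s \<omega>)"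
      using assms(2) by (simp add: right_continuous_paths_def)
    ultimately show ?thesis
      using AE_space
    proof eventually_elim
      case (elim \<omega>)
      show ?case
        using tau_greater_iff[OF b t D(2) elim(3,2,1)] elim(4) by (simp add: below_def past_def space_P)
    qed
  qed
  then show thesis using D(1) that by blast
qed

text \<open>The first boundary supplies the survival events and the second one the finite tests. The
  roles can be exchanged, since \<open>mass\<close> is an equality.\<close>

lemma passage_cdf_le:
  assumes diffuse: "\<forall>t>0. diffuse (distr P borel (X t))" and rc: "right_continuous_paths P X"
    and E3: "\<forall>b. boundary_function b \<longrightarrow> (AE \<omega> in P. tau X b \<omega> = tau' X b \<omega>)"
    and b: "boundary_function b1" "boundary_function b2"
    and meas: "tau X b1 \<in> borel_measurable P" "tau X b2 \<in> borel_measurable P"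
    and mass: "\<And>s. 0 < s \<Longrightarrow> emeasure P {\<omega> \<in> space P. ennreal s < tau X b1 \<omega>} =
                           emeasure P {\<omega> \<in> space P. ennreal s < tau X b2 \<omega>}"
    and t: "0 < t"
  shows "emeasure P {\<omega> \<in> space P. ennreal t < tau X b1 \<omega> \<and> X t \<omega> \<le> c} \<le>
         emeasure P {\<omega> \<in> space P. ennreal t < tau X b2 \<omega> \<and> X t \<omega> \<le> c}"
proof -
  define G where "G b s = {\<omega> \<in> space P. ennreal s < tau X b \<omega>}" for b s
  define \<beta> where "\<beta> b u = b (ennreal u)" for b :: "ennreal \<Rightarrow> ereal" and u :: real
  obtain D1 where D1: "countable D1"
    "\<And>t. 0 < t \<Longrightarrow> AE \<omega> in P. \<omega> \<in> G b1 t \<longleftrightarrow> \<omega> \<in> below (\<beta> b1) (past D1 t)"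
    using passage_AE_below[OF diffuse rc E3 b(1)] unfolding G_def \<beta>_def by metis
  obtain D2 where D2: "countable D2"
    "\<And>t. 0 < t \<Longrightarrow> AE \<omega> in P. \<omega> \<in> G b2 t \<longleftrightarrow> \<omega> \<in> below (\<beta> b2) (past D2 t)"
    using passage_AE_below[OF diffuse rc E3 b(2)] unfolding G_def \<beta>_def by metis
  have G_sets [measurable]: "G b1 s \<in> sets P" "G b2 s \<in> sets P" for s
    unfolding G_def using meas by measurable
  have [measurable]: "X t \<in> borel_measurable P" using t by (intro X_measurable_P) simp
  \<comment> \<open>The first \<open>n + 1\<close> terms of an enumeration: finite sets of times
    that increase to \<open>past D2 t\<close>.\<close>
  define S where "S n = from_nat_into (past D2 t) ` {..n}" for n
  have S: "S n \<subseteq> {0<..t}" "finite (S n)" for n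
    unfolding S_def using past(2)[OF t, of D2] from_nat_into[OF past(3)[of D2 t]] by auto
  have S_sets: "{\<omega> \<in> below (\<beta> b2) (S n). X t \<omega> \<le> c} \<in> sets P" for n
    using S[of n] t by (intro X_le_sets sets_P below_sets(3)[of _ t]) (auto intro: countable_finite)
  have "(\<Union>n. S n) = range (from_nat_into (past D2 t))"
    unfolding S_def by force
  also have "\<dots> = past D2 t"
    by (rule range_from_nat_into[OF past(3) past(1)[OF D2(1)]])
  finally have "(\<Union>n. S n) = past D2 t" .
  then have lim_eq: "(\<Inter>n. {\<omega> \<in> below (\<beta> b2) (S n). X t \<omega> \<le> c}) = {\<omega> \<in> below (\<beta> b2) (past D2 t). X t \<omega> \<le> c}"
    by (auto simp: below_def)
  have "emeasure P {\<omega> \<in> G b1 t. X t \<omega> \<le> c} \<le> emeasure P {\<omega> \<in> below (\<beta> b2) (S n). X t \<omega> \<le> c}" for n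
  proof (rule survival_cdf_le_below)
    show "G b1 r \<subseteq> G b1 s" if "s \<le> r" for s r
      using that by (auto simp: G_def intro: order.strict_trans1 ennreal_leI)
    show "\<exists>A\<in>sets PA \<inter> sets (F s). AE \<omega> in P. \<omega> \<in> G b1 s \<longleftrightarrow> \<omega> \<in> A" if "0 < s" for s
    proof -
      have "past D1 s \<subseteq> {0..s}" using past(2)[OF that, of D1] by auto
      then show ?thesis
        using that D1(2) below_sets[OF past(1)[OF D1(1)]]
        by (intro bexI[of _ "below (\<beta> b1) (past D1 s)"]) simp_all
    qed
    show "emeasure P (G b1 s) \<le> emeasure P (below (\<beta> b2) S)" if "0 < s" "finite S" "S \<subseteq> {0<..s}" for s S
    proof -
      \<comment> \<open>The two survival events have equal mass, and surviving \<open>b2\<close>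
        forces every test against \<open>b2\<close>, path by path.\<close>
      have "emeasure P (G b1 s) = emeasure P (G b2 s)" using mass \<open>0 < s\<close> by (simp add: G_def)
      also have "\<dots> \<le> emeasure P (below (\<beta> b2) S)"
        using that passage_subset_below[of S s b2] unfolding G_def \<beta>_def
        by (intro emeasure_mono sets_P below_sets(3)[of _ s]) (auto intro: countable_finite)
      finally show ?thesis .
    qed
  qed (use S t in auto)
  moreover have "(\<lambda>n. emeasure P {\<omega> \<in> below (\<beta> b2) (S n). X t \<omega> \<le> c}) \<longlonglongrightarrow>
      emeasure P (\<Inter>n. {\<omega> \<in> below (\<beta> b2) (S n). X t \<omega> \<le> c})"
    using S_sets
    by (intro Lim_emeasure_decseq) (fastforce simp: decseq_def below_def S_def)+
  ultimately have "emeasure P {\<omega> \<in> G b1 t. X t \<omega> \<le> c} \<le>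
      emeasure P {\<omega> \<in> below (\<beta> b2) (past D2 t). X t \<omega> \<le> c}"
    unfolding lim_eq by (intro LIMSEQ_le_const) auto
  also have "\<dots> = emeasure P {\<omega> \<in> G b2 t. X t \<omega> \<le> c}"
  proof (rule emeasure_eq_AE)
    show "AE \<omega> in P. (\<omega> \<in> {\<omega> \<in> below (\<beta> b2) (past D2 t). X t \<omega> \<le> c}) = (\<omega> \<in> {\<omega> \<in> G b2 t. X t \<omega> \<le> c})"
      using D2(2)[OF t] by (auto elim: eventually_mono)
    show "{\<omega> \<in> below (\<beta> b2) (past D2 t). X t \<omega> \<le> c} \<in> sets P"
      using past(1)[OF D2(1), of t] past(2)[OF t, of D2]
      by (intro X_le_sets sets_P below_sets(3)[of _ t]) auto
  qed (auto intro: X_le_sets)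
  finally show ?thesis by (simp add: G_def conj_assoc)
qed

section \<open>Equality of the conditional laws and of the boundaries\<close>

lemma cond_law_unique:
  assumes diffuse: "\<forall>t>0. diffuse (distr P borel (X t))" and rc: "right_continuous_paths P X"
    and E3: "\<forall>b. boundary_function b \<longrightarrow> (AE \<omega> in P. tau X b \<omega> = tau' X b \<omega>)"
    and b: "boundary_function b1" "boundary_function b2"
    and same: "same_distribution P (tau X b1) \<xi>" "same_distribution P (tau X b2) \<xi>"
    and t: "0 < t"
  shows "cond_law P X (tau X b1) t = cond_law P X (tau X b2) t"
proof -
  have meas [measurable]: "tau X b1 \<in> borel_measurable P" "tau X b2 \<in> borel_measurable P"
    and distr: "distr P borel (tau X b1) = distr P borel (tau X b2)"
    using same by (auto simp: same_distribution_def)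
  have [measurable]: "X t \<in> borel_measurable P" using t by (intro X_measurable_P) simp
  have surv: "emeasure P {\<omega> \<in> space P. ennreal s < tau X b \<omega>} = emeasure (distr P borel (tau X b)) {ennreal s<..}"
    if "tau X b \<in> borel_measurable P" for b s
    using that by (simp add: emeasure_distr vimage_def Int_def conj_commute)
  have mass: "emeasure P {\<omega> \<in> space P. ennreal s < tau X b1 \<omega>} =
      emeasure P {\<omega> \<in> space P. ennreal s < tau X b2 \<omega>}" for s
    using distr by (simp add: surv)
  have cdf: "emeasure P {\<omega> \<in> space P. ennreal t < tau X b1 \<omega> \<and> X t \<omega> \<le> c} =
      emeasure P {\<omega> \<in> space P. ennreal t < tau X b2 \<omega> \<and> X t \<omega> \<le> c}" for c
    using passage_cdf_le[OF diffuse rc E3 b meas mass t, of c]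
      passage_cdf_le[OF diffuse rc E3 b(2,1) meas(2,1) mass[symmetric] t, of c] by (rule antisym)
  have eq: "emeasure (cond_law P X (tau X b) t) {..c} =
      emeasure P {\<omega> \<in> space P. ennreal t < tau X b \<omega> \<and> X t \<omega> \<le> c} / emeasure P {\<omega> \<in> space P. ennreal t < tau X b \<omega>}"
    if [measurable]: "tau X b \<in> borel_measurable P" for b c
  proof -
    have "{\<omega> \<in> space P. ennreal t < tau X b \<omega>} \<inter> (X t -` {..c} \<inter> space P) =
        {\<omega> \<in> space P. ennreal t < tau X b \<omega> \<and> X t \<omega> \<le> c}" by auto
    then show ?thesis by (simp add: cond_law_def emeasure_distr)
  qed
  have finite: "finite_borel_measure (cond_law P X (tau X b) t)" if [measurable]: "tau X b \<in> borel_measurable P" for b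
  proof -
    let ?A = "{\<omega> \<in> space P. ennreal t < tau X b \<omega>}"
    \<comment> \<open>If the survival event is null, \<open>uniform_measure\<close> is the zero
      measure, otherwise it has mass one. Both are finite, so the distribution function determines
      the law.\<close>
    have "emeasure (uniform_measure P ?A) (space P) \<le> 1"
      by (cases "emeasure P ?A = 0")
         (auto simp: Int_absorb2 emeasure_uniform_measure less_top[symmetric] intro!: eq_refl ennreal_divide_self)
    then have "emeasure (cond_law P X (tau X b) t) UNIV \<noteq> \<infinity>"
      by (auto simp: cond_law_def emeasure_distr top_unique)
    then show ?thesis
      by (auto simp: finite_borel_measure_def finite_borel_measure_axioms_def cond_law_def
          intro!: finite_measureI)
  qed
  show ?thesis
    using finite[OF meas(1)] finite[OF meas(2)]
    by (rule cdf_unique') (simp add: fun_eq_iff cdf_def measure_def eq meas mass cdf)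
qed

end

theorem theorem2p8:
  fixes E :: "real set" and L R :: ereal
    and M :: "'w measure" and F :: "real \<Rightarrow> 'w measure" and X :: "real \<Rightarrow> 'w \<Rightarrow> real"
    and Px :: "real \<Rightarrow> 'w measure" and \<mu> :: "real measure" and Q P :: "'w measure"
    and \<xi> :: "'w \<Rightarrow> real" and I :: "real set"
  assumes interval: "is_interval E" "closure (ereal ` E) = {L..R}"
    and adapted: "adapted_process M F X"
    and mu: "prob_measure_on E \<mu>"
    and U1: "\<forall>x\<in>E. AE \<omega> in Px x. \<forall>t\<ge>0. X t \<omega> \<in> E" "markov_process E M F X Px"
    and U2: "\<forall>\<nu>1 \<nu>2. \<forall>t>0.
               prob_measure_on E \<nu>1 \<and> prob_measure_on E \<nu>2 \<and> st_le \<nu>1 \<nu>2 \<longrightarrow>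
               st_le (distr (mixture E M X Px \<nu>1) borel (X t))
                     (distr (mixture E M X Px \<nu>2) borel (X t))"
    and P_mu: "mixture_law E M X Px \<mu> Q" "P = completion Q"
    and xi: "\<xi> \<in> borel_measurable P" "\<forall>\<omega>\<in>space P. \<xi> \<omega> > 0"
    and E1: "\<forall>t>0. diffuse (distr P borel (X t))"
    and E2: "right_continuous_paths P X" "quasi_left_continuous P F X"
    and E3: "\<forall>b. boundary_function b \<longrightarrow> (AE \<omega> in P. tau X b \<omega> = tau' X b \<omega>)"
    and U3: "I \<subseteq> {t. 0 < t \<and> ennreal t < t_sup P \<xi>}"
            "\<forall>b. boundary_function b \<and> range b \<subseteq> {L..R} \<and> same_distribution P (tau X b) \<xi> \<longrightarrow>
               (\<forall>t\<in>I. b (ennreal t) = Sup (ereal ` msupp (cond_law P X (tau X b) t)))"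
  shows "\<forall>b1 b2.
           boundary_function b1 \<and> range b1 \<subseteq> {L..R} \<and> same_distribution P (tau X b1) \<xi> \<and>
           boundary_function b2 \<and> range b2 \<subseteq> {L..R} \<and> same_distribution P (tau X b2) \<xi> \<longrightarrow>
           (\<forall>t\<in>I. b1 (ennreal t) = b2 (ennreal t))"
proof (intro allI impI ballI)
  fix b1 b2 t
  assume b: "boundary_function b1 \<and> range b1 \<subseteq> {L..R} \<and> same_distribution P (tau X b1) \<xi> \<and>
             boundary_function b2 \<and> range b2 \<subseteq> {L..R} \<and> same_distribution P (tau X b2) \<xi>"
    and t: "t \<in> I"
  interpret monotone_markov_law E M F X Px \<mu> Q P
    by unfold_locales fact+
  have "cond_law P X (tau X b1) t = cond_law P X (tau X b2) t"
    using b t U3(1) by (intro cond_law_unique[OF E1 E2(1) E3]) auto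
  \<comment> \<open>By (U3) both boundaries take at \<open>t\<close> the value of one and the same
    functional of the conditional law.\<close>
  moreover have "b (ennreal t) = Sup (ereal ` msupp (cond_law P X (tau X b) t))"
    if "boundary_function b" "range b \<subseteq> {L..R}" "same_distribution P (tau X b) \<xi>" for b
    using U3(2) that t by blast
  ultimately show "b1 (ennreal t) = b2 (ennreal t)"
    using b by metis
qed

end
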